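(* Let $\sigma>0$ and $\Sigma=\sigma I_3$. Let $Z_0:\mathbb{R}^3\to\mathbb{C}^6$ be a periodic function with Fourier series $$Z_0(x)=\sum_w\begin{pmatrix}X_w\\ Y_w\end{pmatrix}e^{ix\cdot w},\qquad X_w=\sum_{d=1}^3a_{d,w}v_{d,w},\quad Y_w=\sum_{d=1}^3b_{d,w}v_{d,w},$$ where $w$ runs over nonzero wave vectors in $\mathbb{R}^3$ determined by the periodicity of $Z_0$, such that the real part of $Z_0$ is $(E_0^T,H_0^T)^T$ and $$\sum_w|w|\sum_{1\le d\le3}\big(|a_{d,w}|+|b_{d,w}|\big)<\infty.$$ For each such $w$ define $Z_w(x,t)$ as follows. If $|w|\ne\sigma/2$, put $Z_w(x,t)=\sum_{k=1}^6c_{k,w}Z^k_w(x)e^{i\lambda_{k,w}t}$, with $\lambda_{k,w},Z^k_w,c_{k,w}$ as in the context. If $|w|=\sigma/2$, put $Z_w(x,t)=\sum_{d=1}^3\begin{pmatrix}E_{d,w}(x,t)\\ H_{d,w}(x,t)\end{pmatrix}$, with $E_{d,w},H_{d,w}$ as in the context. Then $Z(x,t)=\sum_wZ_w(x,t)$ solves $$\frac{\partial Z}{\partial t}=\mathbf{B}Z,\qquad Z(x,0)=Z_0(x),$$ and the real part $(E^T,H^T)^T$ of $Z$ solves $$\frac{\partial E}{\partial t}=-\sigma E+\operatorname{curl}H,\quad\frac{\partial H}{\partial t}=-\operatorname{curl}E,\quad E(x,0)=E_0(x),\quad H(x,0)=H_0(x).$$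
   Context: Units are chosen with permittivity and permeability equal to $1$. $\mathbf{B}$ acts on $\mathbb{C}^6$-valued fields by $\mathbf{B}(U^T,W^T)^T=\big((-\sigma U+\operatorname{curl}W)^T,(-\operatorname{curl}U)^T\big)^T$, curl in $x$. For $w=(w_1,w_2,w_3)^T\in\mathbb{R}^3\setminus\{0\}$ put $s_w=w_1+w_2+w_3$, $r_w=(w_2-w_3,w_3-w_1,w_1-w_2)^T$, $\nu_w=\sqrt2\,|r_w|/|w|$, $\mu_{2,w}=-|w|$, $\mu_{3,w}=|w|$. Let $v_{1,w}=w/|w|$. If $r_w\ne0$, then for $d=2,3$, $v_{d,w}=\frac1{\nu_w}\big(\frac{s_w}{|w|^2}w-(1,1,1)^T-i\frac{\mu_{d,w}}{|w|^2}r_w\big)$. If $r_w=0$, so $w_1=w_2=w_3=\omega$, let $v_2=\frac1{\sqrt3}\big(\frac{1+i\sqrt3}2,\frac{1-i\sqrt3}2,-1\big)^T$ and set $v_{2,w}=v_2$ if $\omega\ge0$, $v_{2,w}=\overline{v_2}$ if $\omega<0$, and $v_{3,w}=\overline{v_{2,w}}$. The $v_{d,w}$ form an orthonormal basis of $\mathbb{C}^3$. Case $|w|\neq\sigma/2$. Let $\lambda_{1,w}=0$, $\lambda_{2,w}=i\sigma$, $\lambda_{3,w}=\lambda_{4,w}=\lambda^+:=\frac12\big(i\sigma+\sqrt{4|w|^2-\sigma^2}\big)$, $\lambda_{5,w}=\lambda_{6,w}=\lambda^-:=\frac12\big(i\sigma-\sqrt{4|w|^2-\sigma^2}\big)$ (principal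 complex square root, the same throughout). Let $Z^k_w(x)=e^{ix\cdot w}\begin{pmatrix}X^k_w\\ Y^k_w\end{pmatrix}$ with $(X^1_w,Y^1_w)=(0,v_{1,w})$, $(X^2_w,Y^2_w)=(v_{1,w},0)$, $(X^3_w,Y^3_w)=(\lambda_{3,w}v_{2,w},-i|w|v_{2,w})$, $(X^4_w,Y^4_w)=(\lambda_{4,w}v_{3,w},i|w|v_{3,w})$, $(X^5_w,Y^5_w)=(\lambda_{5,w}v_{2,w},-i|w|v_{2,w})$, $(X^6_w,Y^6_w)=(\lambda_{6,w}v_{3,w},i|w|v_{3,w})$. Let $c_{1,w}=b_{1,w}$, $c_{2,w}=a_{1,w}$ and $$c_{3,w}=\frac{|w|a_{2,w}-i\lambda^-b_{2,w}}{|w|\sqrt{4|w|^2-\sigma^2}},\quad c_{5,w}=\frac{-|w|a_{2,w}+i\lambda^+b_{2,w}}{|w|\sqrt{4|w|^2-\sigma^2}},$$ $$c_{4,w}=\frac{|w|a_{3,w}+i\lambda^-b_{3,w}}{|w|\sqrt{4|w|^2-\sigma^2}},\quad c_{6,w}=-\frac{|w|a_{3,w}+i\lambda^+b_{3,w}}{|w|\sqrt{4|w|^2-\sigma^2}}.$$ Case $|w|=\sigma/2$. Let $$E_{1,w}=a_{1,w}v_{1,w}e^{ix\cdot w-\sigma t},\quad H_{1,w}=b_{1,w}v_{1,w}e^{ix\cdot w},$$ $$E_{2,w}=e^{-|w|t+ix\cdot w}\big(a_{2,w}-|w|(a_{2,w}+b_{2,w})t\big)v_{2,w},\quad H_{2,w}=e^{-|w|t+ix\cdot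 w}\big(b_{2,w}+|w|(a_{2,w}+b_{2,w})t\big)v_{2,w},$$ $$E_{3,w}=e^{-|w|t+ix\cdot w}\big(a_{3,w}-|w|(a_{3,w}-b_{3,w})t\big)v_{3,w},\quad H_{3,w}=e^{-|w|t+ix\cdot w}\big(b_{3,w}-|w|(a_{3,w}-b_{3,w})t\big)v_{3,w}.$$ *)

theory Defs
  imports "HOL-Analysis.Analysis"
begin

text \<open>Fields with values in \<open>\<complex>\<^sup>6\<close> are represented as functions into \<open>(complex^3) \<times> (complex^3)\<close>,
  the pair of the two blocks \<open>U\<close> and \<open>W\<close> (electric and magnetic part).\<close>

definition cvec :: "real^3 \<Rightarrow> complex^3" where
  "cvec u = (\<chi> i. complex_of_real (u $ i))"

definition cnjv :: "complex^3 \<Rightarrow> complex^3" where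
  "cnjv u = (\<chi> i. cnj (u $ i))"

definition Rev :: "complex^3 \<Rightarrow> real^3" where
  "Rev u = (\<chi> i. Re (u $ i))"

definition scale6 :: "complex \<Rightarrow> (complex^3) \<times> (complex^3) \<Rightarrow> (complex^3) \<times> (complex^3)" where
  "scale6 c z = (c *s fst z, c *s snd z)"

text \<open>\<open>pd i j F x\<close> is the partial derivative in direction \<open>i\<close> of the \<open>j\<close>-th component of \<open>F\<close>.
  It is the intended quantity only where \<open>F\<close> is differentiable, so statements about \<open>curl\<close>
  should come with differentiability.\<close>

definition pd :: "3 \<Rightarrow> 3 \<Rightarrow> (real^3 \<Rightarrow> 'a::real_normed_vector^3) \<Rightarrow> real^3 \<Rightarrow> 'a" where
  "pd i j F x = frechet_derivative F (at x) (axis i 1) $ j"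

definition curl :: "(real^3 \<Rightarrow> 'a::real_normed_vector^3) \<Rightarrow> real^3 \<Rightarrow> 'a^3" where
  "curl F x = vector [pd 2 3 F x - pd 3 2 F x,
                      pd 3 1 F x - pd 1 3 F x,
                      pd 1 2 F x - pd 2 1 F x]"

definition Bop :: "real \<Rightarrow> (real^3 \<Rightarrow> (complex^3) \<times> (complex^3)) \<Rightarrow> real^3 \<Rightarrow> (complex^3) \<times> (complex^3)" where
  "Bop \<sigma> F x = (- (\<sigma> *\<^sub>R fst (F x)) + curl (\<lambda>y. snd (F y)) x, - curl (\<lambda>y. fst (F y)) x)"

text \<open>For a lattice of periods generated by \<open>p 1\<close>, \<open>p 2\<close>, \<open>p 3\<close>, the wave vectors are those
  \<open>w\<close> for which the plane wave with phase \<open>x \<bullet> w\<close> has these periods (the dual lattice,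
  scaled by \<open>2\<pi>\<close>).\<close>

definition wave_vectors :: "(3 \<Rightarrow> real^3) \<Rightarrow> (real^3) set" where
  "wave_vectors p = {w. w \<noteq> 0 \<and> (\<forall>j. \<exists>n::int. w \<bullet> p j = 2 * pi * of_int n)}"

definition plane_wave :: "real^3 \<Rightarrow> real^3 \<Rightarrow> complex" where
  "plane_wave w x = exp (\<i> * complex_of_real (x \<bullet> w))"

definition svec :: "real^3 \<Rightarrow> real" where
  "svec w = w $ 1 + w $ 2 + w $ 3"

definition rvec :: "real^3 \<Rightarrow> real^3" where
  "rvec w = vector [w $ 2 - w $ 3, w $ 3 - w $ 1, w $ 1 - w $ 2]"

definition nu :: "real^3 \<Rightarrow> real" where
  "nu w = sqrt 2 * norm (rvec w) / norm w"

text \<open>\<open>mu d w\<close> is used for \<open>d = 2, 3\<close> only, and \<open>vb d w\<close> for \<open>d = 1, 2, 3\<close> only.\<close>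

definition mu :: "nat \<Rightarrow> real^3 \<Rightarrow> real" where
  "mu d w = (if d = 2 then - norm w else norm w)"

definition v2const :: "complex^3" where
  "v2const = complex_of_real (1 / sqrt 3) *s
     vector [(1 + \<i> * complex_of_real (sqrt 3)) / 2, (1 - \<i> * complex_of_real (sqrt 3)) / 2, -1]"

text \<open>When \<open>rvec w = 0\<close> all components of \<open>w\<close> agree, so \<open>w $ 1\<close> is their common value.\<close>

definition vb :: "nat \<Rightarrow> real^3 \<Rightarrow> complex^3" where
  "vb d w =
    (if d = 1 then cvec (w /\<^sub>R norm w)
     else if rvec w \<noteq> 0 then
       complex_of_real (1 / nu w) *s
         (cvec ((svec w / (norm w)\<^sup>2) *\<^sub>R w - vector [1, 1, 1])
          - (\<i> * complex_of_real (mu d w / (norm w)\<^sup>2)) *s cvec (rvec w))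
     else if d = 2 then (if w $ 1 \<ge> 0 then v2const else cnjv v2const)
     else (if w $ 1 \<ge> 0 then cnjv v2const else v2const))"

definition fourier_coeff ::
    "(nat \<Rightarrow> real^3 \<Rightarrow> complex) \<Rightarrow> (nat \<Rightarrow> real^3 \<Rightarrow> complex) \<Rightarrow> real^3 \<Rightarrow> (complex^3) \<times> (complex^3)" where
  "fourier_coeff a b w = ((\<Sum>d=1..3. a d w *s vb d w), (\<Sum>d=1..3. b d w *s vb d w))"

definition disc :: "real \<Rightarrow> real^3 \<Rightarrow> complex" where
  "disc \<sigma> w = csqrt (complex_of_real (4 * (norm w)\<^sup>2 - \<sigma>\<^sup>2))"

definition lam_plus :: "real \<Rightarrow> real^3 \<Rightarrow> complex" where
  "lam_plus \<sigma> w = (\<i> * complex_of_real \<sigma> + disc \<sigma> w) / 2"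

definition lam_minus :: "real \<Rightarrow> real^3 \<Rightarrow> complex" where
  "lam_minus \<sigma> w = (\<i> * complex_of_real \<sigma> - disc \<sigma> w) / 2"

text \<open>The index \<open>k\<close> below ranges over \<open>1, \<dots>, 6\<close>, whereas list positions start at \<open>0\<close>.\<close>

definition lam :: "real \<Rightarrow> nat \<Rightarrow> real^3 \<Rightarrow> complex" where
  "lam \<sigma> k w = [0, \<i> * complex_of_real \<sigma>, lam_plus \<sigma> w, lam_plus \<sigma> w,
                lam_minus \<sigma> w, lam_minus \<sigma> w] ! (k - 1)"

definition XY :: "real \<Rightarrow> nat \<Rightarrow> real^3 \<Rightarrow> (complex^3) \<times> (complex^3)" where
  "XY \<sigma> k w =
    (let m = \<i> * complex_of_real (norm w) in
     [(0, vb 1 w),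
      (vb 1 w, 0),
      (lam \<sigma> 3 w *s vb 2 w, (- m) *s vb 2 w),
      (lam \<sigma> 4 w *s vb 3 w, m *s vb 3 w),
      (lam \<sigma> 5 w *s vb 2 w, (- m) *s vb 2 w),
      (lam \<sigma> 6 w *s vb 3 w, m *s vb 3 w)] ! (k - 1))"

definition Zk :: "real \<Rightarrow> nat \<Rightarrow> real^3 \<Rightarrow> real^3 \<Rightarrow> (complex^3) \<times> (complex^3)" where
  "Zk \<sigma> k w x = scale6 (plane_wave w x) (XY \<sigma> k w)"

definition cc ::
    "real \<Rightarrow> (nat \<Rightarrow> real^3 \<Rightarrow> complex) \<Rightarrow> (nat \<Rightarrow> real^3 \<Rightarrow> complex) \<Rightarrow> nat \<Rightarrow> real^3 \<Rightarrow> complex" where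
  "cc \<sigma> a b k w =
    (let n = complex_of_real (norm w); D = n * disc \<sigma> w;
         lp = lam_plus \<sigma> w; lm = lam_minus \<sigma> w in
     [b 1 w,
      a 1 w,
      (n * a 2 w - \<i> * lm * b 2 w) / D,
      (n * a 3 w + \<i> * lm * b 3 w) / D,
      (- n * a 2 w + \<i> * lp * b 2 w) / D,
      - ((n * a 3 w + \<i> * lp * b 3 w) / D)] ! (k - 1))"

definition EHcrit ::
    "real \<Rightarrow> (nat \<Rightarrow> real^3 \<Rightarrow> complex) \<Rightarrow> (nat \<Rightarrow> real^3 \<Rightarrow> complex) \<Rightarrow> nat \<Rightarrow> real^3 \<Rightarrow> real^3 \<Rightarrow> real
      \<Rightarrow> (complex^3) \<times> (complex^3)" where
  "EHcrit \<sigma> a b d w x t =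
    (let n = complex_of_real (norm w); \<tau> = complex_of_real t;
         e = exp (- n * \<tau> + \<i> * complex_of_real (x \<bullet> w)) in
     [((a 1 w * exp (\<i> * complex_of_real (x \<bullet> w) - complex_of_real \<sigma> * \<tau>)) *s vb 1 w,
       (b 1 w * exp (\<i> * complex_of_real (x \<bullet> w))) *s vb 1 w),
      ((e * (a 2 w - n * (a 2 w + b 2 w) * \<tau>)) *s vb 2 w,
       (e * (b 2 w + n * (a 2 w + b 2 w) * \<tau>)) *s vb 2 w),
      ((e * (a 3 w - n * (a 3 w - b 3 w) * \<tau>)) *s vb 3 w,
       (e * (b 3 w - n * (a 3 w - b 3 w) * \<tau>)) *s vb 3 w)] ! (d - 1))"

definition Zw ::
    "real \<Rightarrow> (nat \<Rightarrow> real^3 \<Rightarrow> complex) \<Rightarrow> (nat \<Rightarrow> real^3 \<Rightarrow> complex) \<Rightarrow> real^3 \<Rightarrow> real^3 \<Rightarrow> real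
      \<Rightarrow> (complex^3) \<times> (complex^3)" where
  "Zw \<sigma> a b w x t =
    (if norm w \<noteq> \<sigma> / 2
     then (\<Sum>k=1..6. scale6 (cc \<sigma> a b k w * exp (\<i> * lam \<sigma> k w * complex_of_real t)) (Zk \<sigma> k w x))
     else (\<Sum>d=1..3. EHcrit \<sigma> a b d w x t))"

definition Zsol ::
    "(3 \<Rightarrow> real^3) \<Rightarrow> real \<Rightarrow> (nat \<Rightarrow> real^3 \<Rightarrow> complex) \<Rightarrow> (nat \<Rightarrow> real^3 \<Rightarrow> complex)
      \<Rightarrow> real^3 \<Rightarrow> real \<Rightarrow> (complex^3) \<times> (complex^3)" where
  "Zsol p \<sigma> a b x t = (\<Sum>\<^sub>\<infinity>w\<in>wave_vectors p. Zw \<sigma> a b w x t)"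

end

theory Submission
  imports Defs
begin

text \<open>
On a plane wave \<open>exp (\<i> * (x \<bullet> w)) U\<close> the curl acts on the amplitude as \<open>U \<mapsto> \<i> w \<times> U\<close>. The vectors \<open>vb d w\<close>
are eigenvectors of this map with the real eigenvalues \<open>\<mu> = 0, - norm w, norm w\<close> (\<open>icross_vb\<close>). If both fields point
along one of them, with amplitudes \<open>\<alpha>\<close> and \<open>\<beta>\<close>, then the Maxwell system becomes the ordinary differential equation
\<open>\<alpha>' = - \<sigma> \<alpha> + \<mu> \<beta>\<close>, \<open>\<beta>' = - \<mu> \<alpha>\<close>. With the time dependence \<open>exp (\<i> l t)\<close> its characteristic equation is
\<open>l\<^sup>2 = \<i> \<sigma> l + \<mu>\<^sup>2\<close>, which for \<open>\<mu>\<^sup>2 = |w|\<^sup>2\<close> has two different roots if \<open>norm w \<noteq> \<sigma> / 2\<close> and a double root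
otherwise. The explicit formulas in the two cases are just the solutions of this equation with initial values
\<open>a d w\<close> and \<open>b d w\<close> (\<open>Zw_amplitudes\<close>).

It remains to sum over \<open>w\<close>. The coefficients of the single exponentials may become large near the
resonance \<open>2 * norm w = \<sigma>\<close>, so they are not estimated at all. Instead the energy \<open>|\<alpha>|\<^sup>2 + |\<beta>|\<^sup>2\<close> is used, whose
derivative is \<open>- 2 \<sigma> |\<alpha>|\<^sup>2\<close>; it bounds the amplitudes at time \<open>t\<close> by the initial ones, with a factor that does not
depend on \<open>w\<close> (\<open>damped_energy_bound\<close>). Since the nonzero wave vectors of a lattice are bounded away from zero
(\<open>wave_vectors_norm_ge\<close>), the weighted summability of the initial amplitudes dominates the series and its
first derivatives in space and time, locally uniformly in time. The series can then be differentiated term by term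
(\<open>has_derivative_infsum\<close>), and the curl, being linear in the derivative, commutes with the summation
(\<open>Zsol_solves\<close>). The system has real coefficients, so the real part of the solution solves it as well.
\<close>

section \<open>Termwise differentiation of infinite sums\<close>

lemma has_sum_diff:
  fixes f g :: "'i \<Rightarrow> 'a::topological_ab_group_add"
  assumes "(f has_sum s) A" and "(g has_sum t) A"
  shows "((\<lambda>i. f i - g i) has_sum s - t) A"
  using assms tendsto_diff unfolding has_sum_def sum_subtractf by blast

text \<open>The derivatives are dominated by a summable family, uniformly on a convex set. By the mean value
inequality a single remainder \<open>f i y - f i x - f' i x (y - x)\<close> is then at most \<open>2 * M i * norm (y - x)\<close>,
so all indices outside a finite set together contribute only a small multiple of \<open>norm (y - x)\<close>,
and the finitely many others are differentiated one by one.\<close>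

lemma has_derivative_infsum:
  fixes f :: "'i \<Rightarrow> 'a::real_normed_vector \<Rightarrow> 'b::banach"
  assumes S: "convex S" "open S" and x: "x \<in> S"
    and der: "\<And>i y. i \<in> I \<Longrightarrow> y \<in> S \<Longrightarrow> (f i has_derivative f' i y) (at y)"
    and bound: "\<And>i y h. i \<in> I \<Longrightarrow> y \<in> S \<Longrightarrow> norm (f' i y h) \<le> M i * norm h"
    and M0: "\<And>i. i \<in> I \<Longrightarrow> 0 \<le> M i" and M: "M summable_on I"
    and summ: "\<And>y. y \<in> S \<Longrightarrow> (\<lambda>i. f i y) summable_on I"
  shows "((\<lambda>y. \<Sum>\<^sub>\<infinity>i\<in>I. f i y) has_derivative (\<lambda>h. \<Sum>\<^sub>\<infinity>i\<in>I. f' i x h)) (at x)"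
proof -
  have summ': "(\<lambda>i. f' i x h) summable_on I" for h
    by (rule abs_summable_summable[OF Infinite_Sum.abs_summable_on_comparison_test'[OF summable_on_cmult_left[OF M, of "norm h"]]])
       (use bound x in auto)
  define g where "g y = (\<Sum>\<^sub>\<infinity>i\<in>I. f i y)" for y
  define g' where "g' h = (\<Sum>\<^sub>\<infinity>i\<in>I. f' i x h)" for h
  have lin: "linear (f' i x)" if "i \<in> I" for i
    using der[OF that x] by (simp add: has_derivative_linear)
  have bl: "bounded_linear g'"
  proof (rule bounded_linear_intro)
    show "g' (u + v) = g' u + g' v" for u v
    proof -
      have "g' (u + v) = (\<Sum>\<^sub>\<infinity>i\<in>I. f' i x u + f' i x v)"
        unfolding g'_def by (rule infsum_cong) (use lin linear_add in blast)
      then show ?thesis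
        unfolding g'_def by (simp add: infsum_add summ')
    qed
    show "g' (c *\<^sub>R u) = c *\<^sub>R g' u" for c u
    proof -
      have "g' (c *\<^sub>R u) = (\<Sum>\<^sub>\<infinity>i\<in>I. c *\<^sub>R f' i x u)"
        unfolding g'_def by (rule infsum_cong) (use lin linear_scale in blast)
      then show ?thesis
        unfolding g'_def by (simp add: infsum_scaleR_right)
    qed
    show "norm (g' u) \<le> norm u * (\<Sum>\<^sub>\<infinity>i\<in>I. M i)" for u
      unfolding g'_def
      by (rule norm_infsum_le[OF has_sum_infsum[OF summ'] has_sum_cmult_right[OF has_sum_infsum[OF M]]])
         (use bound x in \<open>simp add: mult.commute\<close>)
  qed
  have "\<exists>d>0. \<forall>y. norm (y - x) < d \<longrightarrow> norm (g y - g x - g' (y - x)) \<le> e * norm (y - x)"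
    if e: "e > 0" for e
  proof -
    \<comment> \<open>Outside \<open>F\<close> the remainders add up to at most \<open>2 * (e / 4)\<close>, which leaves \<open>e / 2\<close> for those in \<open>F\<close>.\<close>
    obtain F where F: "finite F" "F \<subseteq> I" and tail: "(\<Sum>\<^sub>\<infinity>i\<in>I - F. M i) \<le> e / 4"
    proof -
      obtain F where F: "finite F" "F \<subseteq> I" "dist (sum M F) (infsum M I) \<le> e / 4"
        using infsum_finite_approximation[OF M, of "e/4"] e by auto
      have "(\<Sum>\<^sub>\<infinity>i\<in>I - F. M i) = infsum M I - sum M F"
        using infsum_Diff[OF M summable_on_finite[OF F(1)] F(2)] F(1) by simp
      also have "\<dots> \<le> e / 4"
        using F(3) unfolding dist_real_def by linarith
      finally show ?thesis using F that by blast
    qed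
    have Mtail: "M summable_on (I - F)"
      by (rule summable_on_subset_banach[OF M]) auto
    have "((\<lambda>y. \<Sum>i\<in>F. f i y) has_derivative (\<lambda>h. \<Sum>i\<in>F. f' i x h)) (at x)"
      by (rule has_derivative_sum) (use F der x in auto)
    then obtain d1 where d1: "d1 > 0"
      "\<And>y. norm (y - x) < d1 \<Longrightarrow>
         norm ((\<Sum>i\<in>F. f i y) - (\<Sum>i\<in>F. f i x) - (\<Sum>i\<in>F. f' i x (y - x))) \<le> e/2 * norm (y - x)"
      unfolding has_derivative_at_alt using e by (metis half_gt_zero)
    obtain d2 where d2: "d2 > 0" "ball x d2 \<subseteq> S"
      using S(2) x openE by blast
    have "norm (g y - g x - g' (y - x)) \<le> e * norm (y - x)" if y: "norm (y - x) < min d1 d2" for y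
    proof -
      have yS: "y \<in> S" using y d2 by (auto simp: dist_norm norm_minus_commute)
      define q where "q i = f i y - f i x - f' i x (y - x)" for i
      have hs: "(q has_sum (g y - g x - g' (y - x))) I"
        unfolding q_def g_def g'_def by (intro has_sum_diff has_sum_infsum summ summ' yS x)
      then have q: "q summable_on I" and eq: "g y - g x - g' (y - x) = infsum q I"
        by (auto simp: summable_on_def infsumI)
      have split: "infsum q I = sum q F + infsum q (I - F)"
        using infsum_Diff[OF q summable_on_finite[OF F(1)] F(2)] F(1) by simp
      have 1: "norm (sum q F) \<le> e/2 * norm (y - x)"
        using d1(2)[of y] y unfolding q_def by (simp add: sum_subtractf)
      have "norm (q i) \<le> M i * (2 * norm (y - x))" if i: "i \<in> I - F" for i
      proof -
        have "norm (f i y - f i x) \<le> M i * norm (y - x)"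
          by (rule differentiable_bound[OF S(1) _ _ yS x, of _ "f' i"])
             (use i der bound M0 in \<open>auto intro: has_derivative_at_withinI onorm_bound\<close>)
        moreover have "norm (f' i x (y - x)) \<le> M i * norm (y - x)"
          using bound x i by auto
        ultimately show ?thesis
          unfolding q_def using norm_triangle_ineq4[of "f i y - f i x" "f' i x (y - x)"] by linarith
      qed
      then have "norm (infsum q (I - F)) \<le> (\<Sum>\<^sub>\<infinity>i\<in>I - F. M i) * (2 * norm (y - x))"
        by (intro norm_infsum_le[OF has_sum_infsum has_sum_cmult_left[OF has_sum_infsum[OF Mtail]]]
            summable_on_subset_banach[OF q]) auto
      also have "\<dots> \<le> e / 4 * (2 * norm (y - x))"
        using tail by (intro mult_right_mono) auto
      finally show ?thesis
        unfolding eq split using 1 norm_triangle_ineq[of "sum q F" "infsum q (I - F)"] by linarith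
    qed
    then show ?thesis using d1(1) d2(1) by (intro exI[of _ "min d1 d2"]) auto
  qed
  then show ?thesis
    using bl unfolding has_derivative_at_alt g_def g'_def by blast
qed

section \<open>The energy of a damped rotation\<close>

text \<open>The energy \<open>\<alpha> \<bullet> \<alpha> + \<beta> \<bullet> \<beta>\<close> has derivative \<open>- 2 * \<sigma> * (\<alpha> \<bullet> \<alpha>)\<close>, because the rotation with frequency \<open>\<mu>\<close>
conserves it. It decreases forwards in time, and backwards in time it grows at most like
\<open>exp (2 * \<sigma> * \<bar>t\<bar>)\<close>. The bound is independent of \<open>\<mu>\<close>; this is what makes it usable for a whole series
of modes, whose explicit solutions have denominators that tend to zero when \<open>2 * \<bar>\<mu>\<bar>\<close> approaches \<open>\<sigma>\<close>.\<close>

lemma damped_energy_bound: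
  fixes \<alpha> \<beta> :: "real \<Rightarrow> 'a::real_inner"
  assumes \<sigma>: "\<sigma> \<ge> 0"
    and \<alpha>: "\<And>t. (\<alpha> has_vector_derivative - (\<sigma> *\<^sub>R \<alpha> t) + \<mu> *\<^sub>R \<beta> t) (at t)"
    and \<beta>: "\<And>t. (\<beta> has_vector_derivative - (\<mu> *\<^sub>R \<alpha> t)) (at t)"
  shows "norm (\<alpha> t) + norm (\<beta> t) \<le> 2 * exp (\<sigma> * \<bar>t\<bar>) * (norm (\<alpha> 0) + norm (\<beta> 0))"
proof -
  define N where "N s = \<alpha> s \<bullet> \<alpha> s + \<beta> s \<bullet> \<beta> s" for s
  have N: "(N has_real_derivative - 2 * \<sigma> * (\<alpha> s \<bullet> \<alpha> s)) (at s)" for s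
  proof -
    have "(N has_vector_derivative
        (\<alpha> s \<bullet> (- (\<sigma> *\<^sub>R \<alpha> s) + \<mu> *\<^sub>R \<beta> s) + (- (\<sigma> *\<^sub>R \<alpha> s) + \<mu> *\<^sub>R \<beta> s) \<bullet> \<alpha> s)
        + (\<beta> s \<bullet> (- (\<mu> *\<^sub>R \<alpha> s)) + (- (\<mu> *\<^sub>R \<alpha> s)) \<bullet> \<beta> s)) (at s)"
      unfolding N_def
      by (intro has_vector_derivative_add
          bounded_bilinear.has_vector_derivative[OF bounded_bilinear_inner] \<alpha> \<beta>)
    then show ?thesis
      unfolding has_real_derivative_iff_has_vector_derivative
      by (simp add: inner_diff_left inner_diff_right inner_add_left inner_add_right inner_commute algebra_simps)
  qed
  have N0: "N s \<ge> 0" for s unfolding N_def by simp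
  have main: "N t \<le> exp (2 * \<sigma> * \<bar>t\<bar>) * N 0"
  proof (cases "t \<ge> 0")
    case True
    have "- 2 * \<sigma> * (\<alpha> s \<bullet> \<alpha> s) \<le> 0" for s
      using \<sigma> by simp
    then have "N t \<le> N 0"
      using N by (intro DERIV_nonpos_imp_nonincreasing[OF True]) blast
    also have "\<dots> \<le> exp (2 * \<sigma> * \<bar>t\<bar>) * N 0"
      using N0[of 0] \<sigma> by (simp add: mult_le_cancel_right1)
    finally show ?thesis .
  next
    case False
    \<comment> \<open>Multiplying by \<open>exp (2 * \<sigma> * s)\<close> turns the loss \<open>- 2 * \<sigma> * (\<alpha> \<bullet> \<alpha>)\<close> into the gain \<open>2 * \<sigma> * (\<beta> \<bullet> \<beta>)\<close>.\<close>
    have "((\<lambda>s. exp (2 * \<sigma> * s) * N s) has_real_derivative exp (2 * \<sigma> * s) * (2 * \<sigma> * (\<beta> s \<bullet> \<beta> s))) (at s)" for s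
      by (rule derivative_eq_intros N refl | simp add: N_def algebra_simps)+
    moreover have "exp (2 * \<sigma> * s) * (2 * \<sigma> * (\<beta> s \<bullet> \<beta> s)) \<ge> 0" for s
      using \<sigma> by simp
    ultimately have "\<exists>y. ((\<lambda>s. exp (2 * \<sigma> * s) * N s) has_real_derivative y) (at s) \<and> y \<ge> 0" for s
      by blast
    then have "exp (2 * \<sigma> * t) * N t \<le> exp (2 * \<sigma> * 0) * N 0"
      using False by (intro DERIV_nonneg_imp_nondecreasing[where f = "\<lambda>s. exp (2 * \<sigma> * s) * N s"]) auto
    then show ?thesis using False by (simp add: exp_minus field_simps)
  qed
  define c where "c = exp (\<sigma> * \<bar>t\<bar>) * (norm (\<alpha> 0) + norm (\<beta> 0))"
  have "N 0 \<le> (norm (\<alpha> 0) + norm (\<beta> 0))\<^sup>2"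
    unfolding N_def by (simp add: dot_square_norm power2_sum)
  then have "N t \<le> exp (2 * \<sigma> * \<bar>t\<bar>) * (norm (\<alpha> 0) + norm (\<beta> 0))\<^sup>2"
    using main by (meson exp_ge_zero mult_left_mono order_trans)
  also have "\<dots> = c\<^sup>2"
    unfolding c_def by (simp add: power_mult_distrib flip: exp_double)
  finally have "(norm (\<alpha> t))\<^sup>2 \<le> c\<^sup>2" "(norm (\<beta> t))\<^sup>2 \<le> c\<^sup>2"
    unfolding N_def by (auto simp: dot_square_norm intro: order_trans[rotated])
  moreover have "c \<ge> 0" unfolding c_def by simp
  ultimately have "norm (\<alpha> t) \<le> c" "norm (\<beta> t) \<le> c"
    by (auto intro: power2_le_imp_le)
  then show ?thesis unfolding c_def by simp
qed

section \<open>Vectors of complex numbers\<close>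

lemma norm_vector_smult_complex: "norm (c *s (v :: complex^'n)) = norm c * norm v"
  by (simp add: norm_vec_def L2_set_def norm_mult power_mult_distrib real_sqrt_mult
      flip: sum_distrib_left)

lemma norm_scale6: "norm (scale6 c z) = norm c * norm z"
  by (simp add: scale6_def norm_prod_def norm_vector_smult_complex power_mult_distrib
      real_sqrt_mult flip: distrib_left)

lemma bounded_bilinear_scale6: "bounded_bilinear scale6"
proof
  show "\<exists>K. \<forall>c z. norm (scale6 c z) \<le> norm c * norm z * K"
    by (rule exI[of _ 1]) (simp add: norm_scale6)
qed (auto simp: scale6_def vec_eq_iff algebra_simps)

lemma bounded_linear_Rev: "bounded_linear Rev"
  by (rule linear_conv_bounded_linear[THEN iffD1], rule linearI) (auto simp: Rev_def vec_eq_iff)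

lemma has_sum_vecI:
  assumes "\<And>i. ((\<lambda>w. f w $ i) has_sum s $ i) A"
  shows "(f has_sum s) A"
  using assms unfolding has_sum_def by (auto intro!: vec_tendstoI)

lemma has_sum_Pair:
  assumes "(f has_sum s) A" and "(g has_sum t) A"
  shows "((\<lambda>w. (f w, g w)) has_sum (s, t)) A"
  using tendsto_Pair[OF assms[unfolded has_sum_def]] unfolding has_sum_def sum_prod .

section \<open>The curl and its action on plane waves\<close>

text \<open>The curl as a linear function of the total derivative. In this form it can be applied to a derivative
that is itself an infinite sum.\<close>

definition curl_of_deriv :: "(real^3 \<Rightarrow> 'a::real_normed_vector^3) \<Rightarrow> 'a^3" where
  "curl_of_deriv D = vector [D (axis 2 1) $ 3 - D (axis 3 1) $ 2,
                             D (axis 3 1) $ 1 - D (axis 1 1) $ 3,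
                             D (axis 1 1) $ 2 - D (axis 2 1) $ 1]"

lemma curl_eq_curl_of_deriv:
  assumes "(F has_derivative D) (at x)"
  shows "curl F x = curl_of_deriv D"
  using frechet_derivative_at[OF assms] by (simp add: curl_def curl_of_deriv_def pd_def)

lemma has_sum_curl_of_deriv:
  assumes "\<And>h. ((\<lambda>w. D w h) has_sum D' h) A"
  shows "((\<lambda>w. curl_of_deriv (D w)) has_sum curl_of_deriv D') A"
proof -
  have "((\<lambda>w. D w h $ i) has_sum D' h $ i) A" for h i
    using has_sum_bounded_linear[OF bounded_linear_vec_nth assms] .
  then have "\<forall>i. ((\<lambda>w. curl_of_deriv (D w) $ i) has_sum curl_of_deriv D' $ i) A"
    unfolding forall_3 curl_of_deriv_def vector_3 by (intro conjI has_sum_diff)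
  then show ?thesis by (blast intro: has_sum_vecI)
qed

lemma curl_Rev:
  assumes "F differentiable (at x)"
  shows "curl (\<lambda>y. Rev (F y)) x = Rev (curl F x)"
proof -
  obtain D where D: "(F has_derivative D) (at x)"
    using assms by (auto simp: differentiable_def)
  have "((\<lambda>y. Rev (F y)) has_derivative (\<lambda>h. Rev (D h))) (at x)"
    by (rule bounded_linear.has_derivative[OF bounded_linear_Rev D])
  with D show ?thesis
    by (simp add: curl_eq_curl_of_deriv)
       (simp add: curl_of_deriv_def Rev_def vec_eq_iff forall_3)
qed

text \<open>The vector \<open>\<i> w \<times> U\<close>, which is what the curl makes of the amplitude \<open>U\<close> of a plane wave with wave vector \<open>w\<close>.\<close>

definition icross :: "real^3 \<Rightarrow> complex^3 \<Rightarrow> complex^3" where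
  "icross w U = vector [\<i> * (w $ 2 * U $ 3 - w $ 3 * U $ 2),
                        \<i> * (w $ 3 * U $ 1 - w $ 1 * U $ 3),
                        \<i> * (w $ 1 * U $ 2 - w $ 2 * U $ 1)]"

lemma curl_of_deriv_plane_wave:
  "curl_of_deriv (\<lambda>h. (\<i> * complex_of_real (h \<bullet> w)) *s U) = icross w U"
  by (simp add: curl_of_deriv_def icross_def vec_eq_iff forall_3 inner_commute[of _ w] inner_axis algebra_simps)

lemma linear_icross: "linear (icross w)"
  by (rule linearI) (auto simp: icross_def vec_eq_iff forall_3 algebra_simps)

lemma icross_smult: "icross w (c *s U) = c *s icross w U"
  by (simp add: icross_def vec_eq_iff forall_3 algebra_simps)

lemma norm_icross_le: "norm (icross w U) \<le> 6 * norm w * norm U"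
proof -
  have b: "norm (\<i> * (complex_of_real (w $ i) * U $ j - complex_of_real (w $ k) * U $ l)) \<le> 2 * (norm w * norm U)" for i j k l
  proof -
    have "norm (complex_of_real (w $ i) * U $ j) \<le> norm w * norm U" for i j
      unfolding norm_mult norm_of_real
      using component_le_norm_cart[of w i] Finite_Cartesian_Product.norm_nth_le[of U j] by (intro mult_mono) auto
    from this[of i j] this[of k l] show ?thesis
      unfolding norm_mult
      using norm_triangle_ineq4[of "complex_of_real (w $ i) * U $ j" "complex_of_real (w $ k) * U $ l"]
      by (simp add: norm_mult)
  qed
  have "norm (icross w U) \<le> (\<Sum>i\<in>UNIV. norm (icross w U $ i))"
    unfolding norm_vec_def by (rule L2_set_le_sum) simp
  also have "\<dots> \<le> 6 * norm w * norm U"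
    unfolding sum_3 icross_def vector_3 using b[of 2 3 3 2] b[of 3 1 1 3] b[of 1 2 2 1] by linarith
  finally show ?thesis .
qed

section \<open>The polarisation vectors as eigenvectors\<close>

text \<open>The eigenvalue of \<open>icross w\<close> on \<open>vb d w\<close>: zero for the longitudinal vector \<open>d = 1\<close>, and \<open>- norm w\<close>, \<open>norm w\<close>
for the two circular polarisations \<open>d = 2, 3\<close>.\<close>

definition rot_freq :: "nat \<Rightarrow> real^3 \<Rightarrow> real" where
  "rot_freq d w = (if d = 1 then 0 else mu d w)"

lemma norm_cvec: "norm (cvec u) = norm u"
  by (simp add: norm_vec_def cvec_def)

lemma norm_power2_3: "(norm (w :: real^3))\<^sup>2 = (w $ 1)\<^sup>2 + (w $ 2)\<^sup>2 + (w $ 3)\<^sup>2"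
  by (simp add: norm_vec_def L2_set_def sum_3)

lemma mu_power2: "(mu d w)\<^sup>2 = (norm w)\<^sup>2"
  by (simp add: mu_def)

text \<open>With \<open>u = (1, 1, 1)\<close> one has \<open>rvec w = w \<times> u\<close>, and \<open>- U\<close> is the component of \<open>u\<close> orthogonal to \<open>w\<close>
plus \<open>\<i> m / |w|\<^sup>2\<close> times \<open>w \<times> u\<close>. Crossing with \<open>w\<close> exchanges these two real vectors up to
factors, since \<open>w \<times> (w \<times> u) = (w \<bullet> u) w - |w|\<^sup>2 u\<close>. In coordinates
the three eigenvalue equations are polynomial consequences of \<open>q |w|\<^sup>2 = 1\<close>, \<open>m\<^sup>2 = |w|\<^sup>2\<close> and \<open>\<i>\<^sup>2 = -1\<close>.\<close>

lemma icross_nondegenerate: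
  fixes w :: "real^3"
  assumes "w \<noteq> 0" and m: "m\<^sup>2 = (norm w)\<^sup>2"
  defines "U \<equiv> cvec ((svec w / (norm w)\<^sup>2) *\<^sub>R w - vector [1, 1, 1])
            - (\<i> * complex_of_real (m / (norm w)\<^sup>2)) *s cvec (rvec w)"
  shows "icross w U = complex_of_real m *s U"
proof -
  define q where "q = complex_of_real (1 / (norm w)\<^sup>2)"
  define M where "M = complex_of_real m"
  define x y z where "x = complex_of_real (w $ 1)" and "y = complex_of_real (w $ 2)" and "z = complex_of_real (w $ 3)"
  have k: "complex_of_real ((norm w)\<^sup>2) = x\<^sup>2 + y\<^sup>2 + z\<^sup>2"
    unfolding norm_power2_3 x_def y_def z_def by simp
  have q: "q * (x\<^sup>2 + y\<^sup>2 + z\<^sup>2) = 1"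
    using assms(1) unfolding k[symmetric] q_def by (simp flip: of_real_mult)
  have M: "M\<^sup>2 = x\<^sup>2 + y\<^sup>2 + z\<^sup>2"
    using k m unfolding M_def by (simp flip: of_real_power)
  have i2: "\<i>\<^sup>2 = -1" by simp
  have U: "U $ 1 = (x + y + z) * q * x - 1 - \<i> * M * q * (y - z)"
          "U $ 2 = (x + y + z) * q * y - 1 - \<i> * M * q * (z - x)"
          "U $ 3 = (x + y + z) * q * z - 1 - \<i> * M * q * (x - y)"
    unfolding U_def q_def M_def x_def y_def z_def
    by (simp_all add: cvec_def rvec_def svec_def divide_inverse algebra_simps)
  have "\<i> * (y * U $ 3 - z * U $ 2) = M * U $ 1"
       "\<i> * (z * U $ 1 - x * U $ 3) = M * U $ 2"
       "\<i> * (x * U $ 2 - y * U $ 1) = M * U $ 3"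
    unfolding U using q M i2 by algebra+
  then show ?thesis
    unfolding vec_eq_iff forall_3 icross_def by (simp add: M_def x_def y_def z_def)
qed

lemma vb_nondegenerate:
  assumes "d \<noteq> 1" and "rvec w \<noteq> 0"
  shows "vb d w = complex_of_real (1 / nu w) *s
    (cvec ((svec w / (norm w)\<^sup>2) *\<^sub>R w - vector [1, 1, 1])
     - (\<i> * complex_of_real (mu d w / (norm w)\<^sup>2)) *s cvec (rvec w))"
  using assms unfolding vb_def by (simp only: if_False if_True simp_thms)

text \<open>On the diagonal \<open>w = (\<omega>, \<omega>, \<omega>)\<close> the eigenvalue \<open>- sqrt 3 * \<omega>\<close> changes sign with \<open>\<omega>\<close>. The case distinction on the
sign of \<open>w $ 1\<close> in \<^const>\<open>vb\<close> undoes this, since complex conjugation of the vector negates the eigenvalue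
(\<open>icross_cnjv\<close> below).\<close>

lemma icross_v2const:
  assumes "w $ 2 = w $ 1" and "w $ 3 = w $ 1"
  shows "icross w v2const = complex_of_real (- sqrt 3 * w $ 1) *s v2const"
proof -
  define r where "r = complex_of_real (sqrt 3)"
  have r: "r * r = 3" unfolding r_def by (simp flip: of_real_mult)
  show ?thesis
    unfolding vec_eq_iff forall_3 icross_def v2const_def
    using assms r by (simp flip: r_def add: field_simps)
qed

lemma icross_cnjv: "icross w (cnjv U) = - cnjv (icross w U)"
  by (simp add: vec_eq_iff forall_3 icross_def cnjv_def)

lemma icross_vb:
  assumes w: "w \<noteq> 0"
  shows "icross w (vb d w) = complex_of_real (rot_freq d w) *s vb d w"
proof (cases "d = 1")
  case True
  then show ?thesis
    by (simp add: vb_def rot_freq_def icross_def cvec_def vec_eq_iff forall_3)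
next
  case d: False
  show ?thesis
  proof (cases "rvec w = 0")
    case False
    define U where "U = cvec ((svec w / (norm w)\<^sup>2) *\<^sub>R w - vector [1, 1, 1])
            - (\<i> * complex_of_real (mu d w / (norm w)\<^sup>2)) *s cvec (rvec w)"
    have vb: "vb d w = complex_of_real (1 / nu w) *s U"
      unfolding U_def using d False by (rule vb_nondegenerate)
    have "icross w U = complex_of_real (mu d w) *s U"
      unfolding U_def by (rule icross_nondegenerate[OF w mu_power2])
    then show ?thesis
      using d by (simp add: vb icross_smult rot_freq_def)
  next
    case True
    then have "rvec w $ 2 = 0" "rvec w $ 3 = 0" by simp_all
    then have eq: "w $ 2 = w $ 1" "w $ 3 = w $ 1" by (simp_all add: rvec_def)
    have n: "norm w = sqrt 3 * \<bar>w $ 1\<bar>"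
      by (rule power2_eq_imp_eq) (simp_all add: norm_power2_3 eq power_mult_distrib)
    have c: "icross w (cnjv v2const) = complex_of_real (sqrt 3 * w $ 1) *s cnjv v2const"
      unfolding icross_cnjv icross_v2const[OF eq] by (simp add: cnjv_def vec_eq_iff)
    show ?thesis
      using d True by (simp add: vb_def rot_freq_def mu_def n c icross_v2const[OF eq])
  qed
qed

lemma norm_v2const: "norm v2const = 1"
proof -
  have "norm ((1 + \<i> * complex_of_real (sqrt 3)) / 2) = 1" "norm ((1 - \<i> * complex_of_real (sqrt 3)) / 2) = 1"
    by (simp_all add: norm_divide cmod_def power_divide)
  then show ?thesis
    unfolding v2const_def norm_vector_smult_complex by (simp add: norm_divide norm_vec_def L2_set_def sum_3)
qed

text \<open>The vectors are unit vectors, but a bound that is uniform in \<open>w\<close> suffices for the convergence of the series.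
Away from the diagonal the real and the imaginary part inside the bracket both have norm
\<open>norm (rvec w) / norm w\<close>, and division by \<^const>\<open>nu\<close> leaves \<open>sqrt 2\<close> by the triangle inequality.\<close>

lemma norm_vb_le:
  assumes w: "w \<noteq> 0"
  shows "norm (vb d w) \<le> 2"
proof -
  have 1: "norm (cvec (w /\<^sub>R norm w)) \<le> 2"
    using w by (simp add: norm_cvec)
  have 2: "norm (cnjv v2const) = 1"
    using norm_v2const by (simp add: cnjv_def norm_vec_def)
  have 3: "norm (vb d w) \<le> 2" if d: "d \<noteq> 1" and r: "rvec w \<noteq> 0"
  proof -
    define n where "n = norm w"
    have n: "n > 0" using w by (simp add: n_def)
    let ?u = "(svec w / (norm w)\<^sup>2) *\<^sub>R w - vector [1, 1, 1]"
    have "(norm ?u)\<^sup>2 = (norm (rvec w) / n)\<^sup>2"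
    proof -
      define x y z q where "x = w $ 1" and "y = w $ 2" and "z = w $ 3" and "q = 1 / n\<^sup>2"
      have "n\<^sup>2 = x\<^sup>2 + y\<^sup>2 + z\<^sup>2"
        by (simp add: norm_power2_3 n_def x_def y_def z_def)
      then have q: "q * (x\<^sup>2 + y\<^sup>2 + z\<^sup>2) = 1"
        using n by (simp add: q_def flip: \<open>n\<^sup>2 = _\<close>)
      have "(norm ?u)\<^sup>2 = ((x + y + z) * q * x - 1)\<^sup>2 + ((x + y + z) * q * y - 1)\<^sup>2 + ((x + y + z) * q * z - 1)\<^sup>2"
        unfolding norm_power2_3[of ?u] by (simp add: svec_def x_def y_def z_def q_def n_def)
      also have "\<dots> = q * ((y - z)\<^sup>2 + (z - x)\<^sup>2 + (x - y)\<^sup>2)"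
        using q by algebra
      also have "\<dots> = (norm (rvec w) / n)\<^sup>2"
        unfolding power_divide norm_power2_3[of "rvec w"] by (simp add: rvec_def x_def y_def z_def q_def power_divide)
      finally show ?thesis .
    qed
    then have u: "norm ?u = norm (rvec w) / n"
      using n by (simp add: power2_eq_iff_nonneg)
    have "norm (vb d w) = 1 / nu w * norm (cvec ?u - (\<i> * complex_of_real (mu d w / (norm w)\<^sup>2)) *s cvec (rvec w))"
      unfolding vb_nondegenerate[OF d r] norm_vector_smult_complex norm_of_real by (simp add: nu_def)
    also have "\<dots> \<le> 1 / nu w * (norm (rvec w) / n + norm (rvec w) / n)"
    proof (rule mult_left_mono)
      have "norm ((\<i> * complex_of_real (mu d w / (norm w)\<^sup>2)) *s cvec (rvec w)) = norm (rvec w) / n"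
        using n unfolding norm_vector_smult_complex norm_cvec
        by (simp add: norm_mult norm_divide mu_def n_def[symmetric] power2_eq_square)
      then show "norm (cvec ?u - (\<i> * complex_of_real (mu d w / (norm w)\<^sup>2)) *s cvec (rvec w))
          \<le> norm (rvec w) / n + norm (rvec w) / n"
        using norm_triangle_ineq4[of "cvec ?u"] by (metis norm_cvec u)
      show "0 \<le> 1 / nu w" by (simp add: nu_def)
    qed
    also have "\<dots> = sqrt 2"
      using r n by (simp add: nu_def n_def[symmetric] field_simps)
    also have "\<dots> \<le> 2" by (rule real_le_lsqrt) auto
    finally show ?thesis .
  qed
  show ?thesis
    using 1 2 3 norm_v2const by (cases "d = 1"; cases "rvec w = 0") (auto simp: vb_def)
qed

section \<open>The shortest wave vector\<close>

text \<open>Three independent periods span the space, so a nonzero wave vector has a nonzero inner product with one of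
them. This product is a multiple of \<open>2 * pi\<close>, hence not small, and by Cauchy-Schwarz neither is the wave vector.\<close>

lemma wave_vectors_norm_ge:
  assumes "inj p" and "independent (range p)"
  obtains \<delta> where "\<delta> > 0" and "\<And>w. w \<in> wave_vectors p \<Longrightarrow> \<delta> \<le> norm w"
proof -
  define K where "K = 1 + (\<Sum>j\<in>UNIV. norm (p j))"
  have K0: "K > 0" unfolding K_def by (simp add: add_pos_nonneg sum_nonneg)
  have "card (range p) = 3"
    using card_image[OF assms(1)] by simp
  then have span: "span (range p) = UNIV"
    using card_ge_dim_independent[of "range p" UNIV] assms(2) by auto
  have "2 * pi / K \<le> norm w" if w: "w \<in> wave_vectors p" for w
  proof -
    have "\<exists>j. w \<bullet> p j \<noteq> 0"
    proof (rule ccontr)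
      assume "\<nexists>j. w \<bullet> p j \<noteq> 0"
      then have "orthogonal w x" if "x \<in> span (range p)" for x
        by (intro orthogonal_to_span[OF that]) (auto simp: orthogonal_def)
      then have "orthogonal w w" using span by blast
      then show False
        using w by (simp add: orthogonal_def wave_vectors_def)
    qed
    then obtain j n where j: "w \<bullet> p j \<noteq> 0" "w \<bullet> p j = 2 * pi * of_int n"
      using w unfolding wave_vectors_def by blast
    then have "n \<noteq> 0" by auto
    then have "1 \<le> \<bar>real_of_int n\<bar>" by linarith
    then have "2 * pi * 1 \<le> 2 * pi * \<bar>real_of_int n\<bar>"
      by (intro mult_left_mono) auto
    also have "\<dots> = \<bar>w \<bullet> p j\<bar>" using j by (simp add: abs_mult)
    also have "\<dots> \<le> norm w * norm (p j)" by (rule Cauchy_Schwarz_ineq2)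
    also have "norm (p j) \<le> K"
      unfolding K_def using member_le_sum[of j UNIV "\<lambda>j. norm (p j)"] by simp
    then have "norm w * norm (p j) \<le> norm w * K" by (intro mult_left_mono) auto
    finally show ?thesis using K0 by (simp add: field_simps)
  qed
  then show thesis using that[of "2 * pi / K"] K0 by simp
qed

section \<open>Explicit amplitudes of a mode\<close>

text \<open>Amplitudes \<open>\<alpha>\<close> and \<open>\<beta>\<close> of the electric and the magnetic field along a common eigenvector of the curl with
eigenvalue \<open>\<mu>\<close>: the damped Maxwell system restricted to that line.\<close>

definition damped_pair :: "real \<Rightarrow> real \<Rightarrow> (real \<Rightarrow> complex) \<Rightarrow> (real \<Rightarrow> complex) \<Rightarrow> bool" where
  "damped_pair \<sigma> \<mu> \<alpha> \<beta> \<longleftrightarrow>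
    (\<forall>t. (\<alpha> has_vector_derivative - (\<sigma> *\<^sub>R \<alpha> t) + \<mu> *\<^sub>R \<beta> t) (at t)) \<and>
    (\<forall>t. (\<beta> has_vector_derivative - (\<mu> *\<^sub>R \<alpha> t)) (at t))"

text \<open>The explicit solutions are restrictions to the real axis of entire functions, for which the rules for
complex derivatives can be used.\<close>

lemma damped_pair_of_field:
  assumes "\<And>z. (f has_field_derivative - (\<sigma> * f z) + \<mu> * g z) (at z)"
    and "\<And>z. (g has_field_derivative - (\<mu> * f z)) (at z)"
  shows "damped_pair \<sigma> \<mu> (\<lambda>t. f (complex_of_real t)) (\<lambda>t. g (complex_of_real t))"
  unfolding damped_pair_def
  using has_vector_derivative_real_field[OF assms(1)] has_vector_derivative_real_field[OF assms(2)]
  by (simp add: scaleR_conv_of_real)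

lemma damped_pair_add:
  assumes "damped_pair \<sigma> \<mu> \<alpha> \<beta>" and "damped_pair \<sigma> \<mu> \<alpha>' \<beta>'"
  shows "damped_pair \<sigma> \<mu> (\<lambda>t. \<alpha> t + \<alpha>' t) (\<lambda>t. \<beta> t + \<beta>' t)"
  using assms unfolding damped_pair_def
  by (auto intro!: derivative_eq_intros simp: algebra_simps)

text \<open>The hypothesis is the characteristic equation of the system for the time dependence \<open>exp (\<i> * l * t)\<close>. Its
solutions for \<open>\<mu>\<^sup>2 = |w|\<^sup>2\<close> are \<^const>\<open>lam_plus\<close> and \<^const>\<open>lam_minus\<close>.\<close>

lemma damped_pair_exp:
  assumes "l\<^sup>2 = \<i> * complex_of_real \<sigma> * l + (complex_of_real \<mu>)\<^sup>2"
  shows "damped_pair \<sigma> \<mu> (\<lambda>t. c * l * exp (\<i> * l * complex_of_real t))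
                        (\<lambda>t. c * (\<i> * complex_of_real \<mu>) * exp (\<i> * l * complex_of_real t))"
proof (rule damped_pair_of_field)
  fix z
  have "c * l * (exp (\<i> * l * z) * (\<i> * l)) = c * \<i> * l\<^sup>2 * exp (\<i> * l * z)"
    by (simp add: power2_eq_square)
  also have "\<dots> = - (complex_of_real \<sigma> * (c * l * exp (\<i> * l * z))) +
         complex_of_real \<mu> * (c * (\<i> * complex_of_real \<mu>) * exp (\<i> * l * z))"
    unfolding assms by (simp add: algebra_simps power2_eq_square)
  finally show "((\<lambda>a. c * l * exp (\<i> * l * a)) has_field_derivative
         - (complex_of_real \<sigma> * (c * l * exp (\<i> * l * z))) +
         complex_of_real \<mu> * (c * (\<i> * complex_of_real \<mu>) * exp (\<i> * l * z))) (at z)"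
    by (auto intro!: derivative_eq_intros simp: algebra_simps)
  show "((\<lambda>a. c * (\<i> * complex_of_real \<mu>) * exp (\<i> * l * a)) has_field_derivative
        - (complex_of_real \<mu> * (c * l * exp (\<i> * l * z)))) (at z)"
    by (auto intro!: derivative_eq_intros simp: algebra_simps)
qed

lemma damped_pair_longitudinal:
  "damped_pair \<sigma> 0 (\<lambda>t. c * exp (- (complex_of_real \<sigma> * complex_of_real t))) (\<lambda>t. c')"
  by (rule damped_pair_of_field[of "\<lambda>z. c * exp (- (complex_of_real \<sigma> * z))" _ _ "\<lambda>z. c'"])
     (auto intro!: derivative_eq_intros)

text \<open>For \<open>\<sigma> = 2 * n\<close> with \<open>n\<^sup>2 = \<mu>\<^sup>2\<close> the characteristic equation has the double root \<open>\<i> * n\<close>, so that a factor linear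
in time appears. The two signs \<open>\<mu> = - n\<close> and \<open>\<mu> = n\<close> give the two transversal critical modes.\<close>

lemma damped_pair_critical:
  fixes n \<mu> :: real and c c' :: complex
  assumes "\<mu>\<^sup>2 = n\<^sup>2"
  shows "damped_pair (2 * n) \<mu>
      (\<lambda>t. exp (- (complex_of_real n * complex_of_real t)) * (c - (n * c - \<mu> * c') * complex_of_real t))
      (\<lambda>t. exp (- (complex_of_real n * complex_of_real t)) * (c' - (\<mu> * c - n * c') * complex_of_real t))"
proof (rule damped_pair_of_field)
  have m: "(complex_of_real \<mu>)\<^sup>2 = (complex_of_real n)\<^sup>2"
    using assms by (simp flip: of_real_power)
  fix z
  have "exp (- (complex_of_real n * z)) * (- (n * c - \<mu> * c')) + - (n * exp (- (complex_of_real n * z))) * (c - (n * c - \<mu> * c') * z)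
     = - (complex_of_real (2 * n) * (exp (- (complex_of_real n * z)) * (c - (n * c - \<mu> * c') * z)))
       + \<mu> * (exp (- (complex_of_real n * z)) * (c' - (\<mu> * c - n * c') * z))"
    using m unfolding of_real_mult of_real_numeral by algebra
  then show "((\<lambda>z. exp (- (complex_of_real n * z)) * (c - (n * c - \<mu> * c') * z)) has_field_derivative
       - (complex_of_real (2 * n) * (exp (- (complex_of_real n * z)) * (c - (n * c - \<mu> * c') * z)))
       + \<mu> * (exp (- (complex_of_real n * z)) * (c' - (\<mu> * c - n * c') * z))) (at z)"
    by (auto intro!: derivative_eq_intros simp: algebra_simps)
  have "exp (- (complex_of_real n * z)) * (- (\<mu> * c - n * c')) + - (n * exp (- (complex_of_real n * z))) * (c' - (\<mu> * c - n * c') * z)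
     = - (complex_of_real \<mu> * (exp (- (complex_of_real n * z)) * (c - (n * c - \<mu> * c') * z)))"
    using m by algebra
  then show "((\<lambda>z. exp (- (complex_of_real n * z)) * (c' - (\<mu> * c - n * c') * z)) has_field_derivative
       - (complex_of_real \<mu> * (exp (- (complex_of_real n * z)) * (c - (n * c - \<mu> * c') * z)))) (at z)"
    by (auto intro!: derivative_eq_intros simp: algebra_simps)
qed

text \<open>Both cases in the definition of \<^const>\<open>Zw\<close> have the same shape: a plane wave times a combination of the vectors \<^const>\<open>vb\<close>
whose coefficients are damped pairs with the prescribed initial values.\<close>

lemma Zw_amplitudes:
  assumes \<sigma>: "\<sigma> > 0" and w: "w \<noteq> 0"
  obtains A B :: "nat \<Rightarrow> real \<Rightarrow> complex"
  where "\<And>d. d \<in> {1..3} \<Longrightarrow> A d 0 = a d w" and "\<And>d. d \<in> {1..3} \<Longrightarrow> B d 0 = b d w"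
    and "\<And>d. d \<in> {1..3} \<Longrightarrow> damped_pair \<sigma> (rot_freq d w) (A d) (B d)"
    and "\<And>x t. Zw \<sigma> a b w x t =
      scale6 (plane_wave w x) (\<Sum>d=1..3. A d t *s vb d w, \<Sum>d=1..3. B d t *s vb d w)"
proof (cases "norm w = \<sigma> / 2")
  case True
  define n where "n = norm w"
  have \<sigma>n: "\<sigma> = 2 * n" using True n_def by simp
  have set3: "{Suc 0..3} = {1, 2, 3}" by auto
  define A where "A = (\<lambda>d t. if d = 1 then a 1 w * exp (- (complex_of_real \<sigma> * complex_of_real t))
     else exp (- (complex_of_real n * complex_of_real t)) * (a d w - (n * a d w - rot_freq d w * b d w) * complex_of_real t))"
  define B where "B = (\<lambda>d t. if d = 1 then b 1 w
     else exp (- (complex_of_real n * complex_of_real t)) * (b d w - (rot_freq d w * a d w - n * b d w) * complex_of_real t))"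
  show thesis
  proof (rule that[of A B])
    show "damped_pair \<sigma> (rot_freq d w) (A d) (B d)" if "d \<in> {1..3}" for d
    proof (cases "d = 1")
      case True
      then show ?thesis
        using damped_pair_longitudinal by (simp add: A_def B_def rot_freq_def)
    next
      case False
      then have "(rot_freq d w)\<^sup>2 = n\<^sup>2" by (simp add: rot_freq_def mu_power2 n_def)
      from damped_pair_critical[OF this] False show ?thesis
        by (simp add: A_def B_def \<sigma>n)
    qed
    show "Zw \<sigma> a b w x t =
      scale6 (plane_wave w x) (\<Sum>d=1..3. A d t *s vb d w, \<Sum>d=1..3. B d t *s vb d w)" for x t
    proof -
      have e: "exp (\<i> * complex_of_real (x \<bullet> w)) = plane_wave w x"
          "exp (\<i> * complex_of_real (x \<bullet> w) - complex_of_real \<sigma> * complex_of_real t)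
             = plane_wave w x * exp (- (complex_of_real \<sigma> * complex_of_real t))"
          "exp (- complex_of_real n * complex_of_real t + \<i> * complex_of_real (x \<bullet> w))
             = plane_wave w x * exp (- (complex_of_real n * complex_of_real t))"
        by (simp_all add: plane_wave_def flip: exp_add)
      have "Zw \<sigma> a b w x t = (\<Sum>d=1..3. EHcrit \<sigma> a b d w x t)"
        using True by (simp add: Zw_def)
      also have "\<dots> = scale6 (plane_wave w x) (\<Sum>d=1..3. A d t *s vb d w, \<Sum>d=1..3. B d t *s vb d w)"
        unfolding EHcrit_def Let_def n_def[symmetric] e
        by (simp add: set3 A_def B_def rot_freq_def mu_def scale6_def vec_eq_iff flip: n_def)
           (simp add: algebra_simps)
      finally show ?thesis .
    qed
  qed (auto simp: A_def B_def)
next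
  case False
  define n where "n = norm w"
  define D where "D = disc \<sigma> w"
  have n0: "n > 0" using w n_def by simp
  have D2: "D\<^sup>2 = 4 * (complex_of_real n)\<^sup>2 - (complex_of_real \<sigma>)\<^sup>2"
    unfolding D_def disc_def n_def by simp
  have D0: "D \<noteq> 0"
  proof
    assume "D = 0"
    then have "complex_of_real ((2 * n)\<^sup>2) = complex_of_real (\<sigma>\<^sup>2)"
      using D2 by simp
    then have "(2 * n)\<^sup>2 = \<sigma>\<^sup>2" by (simp only: of_real_eq_iff)
    then have "2 * n = \<sigma>" by (rule power2_eq_imp_eq) (use n0 \<sigma> in auto)
    then show False using False n_def by simp
  qed
  define lp where "lp = lam_plus \<sigma> w"
  define lm where "lm = lam_minus \<sigma> w"
  have lpm: "lp = (\<i> * complex_of_real \<sigma> + D) / 2" "lm = (\<i> * complex_of_real \<sigma> - D) / 2"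
    unfolding lp_def lm_def lam_plus_def lam_minus_def D_def by simp_all
  have i2: "\<i>\<^sup>2 = -1" by simp
  have roots: "lp\<^sup>2 = \<i> * complex_of_real \<sigma> * lp + (complex_of_real n)\<^sup>2" "lm\<^sup>2 = \<i> * complex_of_real \<sigma> * lm + (complex_of_real n)\<^sup>2"
  proof -
    have lpm': "2 * lp = \<i> * complex_of_real \<sigma> + D" "2 * lm = \<i> * complex_of_real \<sigma> - D"
      unfolding lpm by simp_all
    have "4 * lp\<^sup>2 = 4 * (\<i> * complex_of_real \<sigma> * lp + (complex_of_real n)\<^sup>2)"
      using lpm' D2 i2 by algebra
    then show "lp\<^sup>2 = \<i> * complex_of_real \<sigma> * lp + (complex_of_real n)\<^sup>2"
      by (subst (asm) mult_cancel_left) simp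
    have "4 * lm\<^sup>2 = 4 * (\<i> * complex_of_real \<sigma> * lm + (complex_of_real n)\<^sup>2)"
      using lpm' D2 i2 by algebra
    then show "lm\<^sup>2 = \<i> * complex_of_real \<sigma> * lm + (complex_of_real n)\<^sup>2"
      by (subst (asm) mult_cancel_left) simp
  qed
  have set3: "{Suc 0..3} = {1, 2, 3}" and set6: "{Suc 0..6} = {1, 2, 3, 4, 5, 6}" by auto
  \<comment> \<open>The coefficients of the modes with \<open>lp\<close> and \<open>lm\<close>: those with numbers 3 and 5 are polarised
    along \<open>vb 2 w\<close>, those with numbers 4 and 6 along \<open>vb 3 w\<close>.\<close>
  define cp where "cp d = cc \<sigma> a b (if d = 2 then 3 else 4) w" for d :: nat
  define cm where "cm d = cc \<sigma> a b (if d = 2 then 5 else 6) w" for d :: nat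
  define A where "A = (\<lambda>d t. if d = 1 then a 1 w * exp (- (complex_of_real \<sigma> * complex_of_real t))
     else cp d * lp * exp (\<i> * lp * complex_of_real t) + cm d * lm * exp (\<i> * lm * complex_of_real t))"
  define B where "B = (\<lambda>d t. if d = 1 then b 1 w
     else cp d * (\<i> * complex_of_real (rot_freq d w)) * exp (\<i> * lp * complex_of_real t)
        + cm d * (\<i> * complex_of_real (rot_freq d w)) * exp (\<i> * lm * complex_of_real t))"
  have diff: "lp - lm = D" unfolding lpm by (simp add: field_simps)
  show thesis
  proof (rule that[of A B])
    show "damped_pair \<sigma> (rot_freq d w) (A d) (B d)" if "d \<in> {1..3}" for d
    proof (cases "d = 1")
      case True
      then show ?thesis
        using damped_pair_longitudinal by (simp add: A_def B_def rot_freq_def)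
    next
      case False
      then have "(complex_of_real (rot_freq d w))\<^sup>2 = (complex_of_real n)\<^sup>2"
        by (simp add: rot_freq_def mu_power2 n_def flip: of_real_power)
      with False roots show ?thesis
        by (simp add: A_def B_def damped_pair_add damped_pair_exp)
    qed
    show "A d 0 = a d w" if "d \<in> {1..3}" for d
    proof -
      have "A 2 0 = (lp - lm) * a 2 w / D" "A 3 0 = (lp - lm) * a 3 w / D"
        using n0 D0 by (simp_all add: A_def cp_def cm_def cc_def Let_def field_simps flip: lp_def lm_def n_def D_def)
      then show ?thesis using that D0 set3 unfolding diff by (auto simp: A_def)
    qed
    show "B d 0 = b d w" if "d \<in> {1..3}" for d
    proof -
      have "B 2 0 = (lp - lm) * b 2 w / D" "B 3 0 = (lp - lm) * b 3 w / D"
        using n0 D0 by (simp_all add: B_def cp_def cm_def cc_def rot_freq_def mu_def Let_def field_simps flip: lp_def lm_def n_def D_def)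
      then show ?thesis using that D0 set3 unfolding diff by (auto simp: B_def)
    qed
    have c12: "cc \<sigma> a b 1 w = b 1 w" "cc \<sigma> a b 2 w = a 1 w"
      by (simp_all add: cc_def Let_def)
    show "Zw \<sigma> a b w x t =
      scale6 (plane_wave w x) (\<Sum>d=1..3. A d t *s vb d w, \<Sum>d=1..3. B d t *s vb d w)" for x t
      using False c12
      by (simp add: Zw_def set3 set6 Zk_def XY_def lam_def Let_def A_def B_def cp_def cm_def rot_freq_def mu_def scale6_def
          vec_eq_iff algebra_simps flip: n_def lp_def lm_def)
  qed
qed

section \<open>The evolution of a single plane wave\<close>

text \<open>The operator \<^const>\<open>Bop\<close> on the amplitudes of a plane wave with wave vector \<open>w\<close>.\<close>

definition maxwell_symbol :: "real \<Rightarrow> real^3 \<Rightarrow> (complex^3) \<times> (complex^3) \<Rightarrow> (complex^3) \<times> (complex^3)" where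
  "maxwell_symbol \<sigma> w z = (- (\<sigma> *\<^sub>R fst z) + icross w (snd z), - icross w (fst z))"

definition amp_size :: "(nat \<Rightarrow> real^3 \<Rightarrow> complex) \<Rightarrow> (nat \<Rightarrow> real^3 \<Rightarrow> complex) \<Rightarrow> real^3 \<Rightarrow> real" where
  "amp_size a b w = (\<Sum>d=1..3. norm (a d w) + norm (b d w))"

lemma amp_size_nonneg: "amp_size a b w \<ge> 0"
  unfolding amp_size_def by (intro sum_nonneg) auto

lemma norm_plane_wave: "norm (plane_wave w x) = 1"
  by (simp add: plane_wave_def norm_exp_i_times)

lemma scale6_scale6: "scale6 c (scale6 c' z) = scale6 (c * c') z"
  by (simp add: scale6_def)

lemma maxwell_symbol_scale6: "maxwell_symbol \<sigma> w (scale6 c z) = scale6 c (maxwell_symbol \<sigma> w z)"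
  by (simp add: maxwell_symbol_def scale6_def icross_smult vec_eq_iff algebra_simps)

lemma norm_maxwell_symbol_le:
  assumes "\<sigma> \<ge> 0"
  shows "norm (maxwell_symbol \<sigma> w z) \<le> (\<sigma> + 12 * norm w) * norm z"
proof -
  have fs: "norm (fst z) \<le> norm z" "norm (snd z) \<le> norm z"
    by (metis norm_fst_le norm_snd_le prod.collapse)+
  have "norm (maxwell_symbol \<sigma> w z) \<le> norm (- (\<sigma> *\<^sub>R fst z) + icross w (snd z)) + norm (- icross w (fst z))"
    unfolding maxwell_symbol_def by (rule norm_Pair_le)
  also have "\<dots> \<le> \<sigma> * norm (fst z) + 6 * norm w * norm (snd z) + 6 * norm w * norm (fst z)"
    using norm_triangle_ineq[of "- (\<sigma> *\<^sub>R fst z)" "icross w (snd z)"] assms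
      norm_icross_le[of w "snd z"] norm_icross_le[of w "fst z"] by simp
  also have "\<dots> \<le> \<sigma> * norm z + 6 * norm w * norm z + 6 * norm w * norm z"
    using fs assms by (intro add_mono mult_left_mono) auto
  finally show ?thesis by (simp add: algebra_simps)
qed

lemma bounded_linear_smult_left: "bounded_linear (\<lambda>c. c *s (v :: complex^'n))"
  by (rule linear_conv_bounded_linear[THEN iffD1], rule linearI) (auto simp: vec_eq_iff algebra_simps)

text \<open>All four facts follow from the description by damped pairs. The eigenvector property turns the equations of
the amplitudes into the symbol of the Maxwell operator, and the energy bound gives a growth estimate whose
only dependence on \<open>w\<close> is through the size of the initial amplitudes.\<close>

lemma
  assumes \<sigma>: "\<sigma> > 0" and w: "w \<noteq> 0"
  shows Zw_time_derivative:
      "((\<lambda>s. Zw \<sigma> a b w x s) has_vector_derivative maxwell_symbol \<sigma> w (Zw \<sigma> a b w x t)) (at t)"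
    and Zw_initial: "Zw \<sigma> a b w x 0 = scale6 (plane_wave w x) (fourier_coeff a b w)"
    and norm_Zw_le: "norm (Zw \<sigma> a b w x t) \<le> 4 * exp (\<sigma> * \<bar>t\<bar>) * amp_size a b w"
    and Zw_space_derivative:
      "((\<lambda>y. Zw \<sigma> a b w y t) has_derivative
        (\<lambda>h. scale6 (\<i> * complex_of_real (h \<bullet> w)) (Zw \<sigma> a b w x t))) (at x)"
proof -
  obtain A B where A0: "\<And>d. d \<in> {1..3} \<Longrightarrow> A d 0 = a d w" and B0: "\<And>d. d \<in> {1..3} \<Longrightarrow> B d 0 = b d w"
    and pair: "\<And>d. d \<in> {1..3} \<Longrightarrow> damped_pair \<sigma> (rot_freq d w) (A d) (B d)"
    and Zw: "\<And>x t. Zw \<sigma> a b w x t =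
      scale6 (plane_wave w x) (\<Sum>d=1..3. A d t *s vb d w, \<Sum>d=1..3. B d t *s vb d w)"
    using Zw_amplitudes[OF \<sigma> w] by blast
  define V where "V t = (\<Sum>d=1..3. A d t *s vb d w, \<Sum>d=1..3. B d t *s vb d w)" for t
  have Zw: "Zw \<sigma> a b w x t = scale6 (plane_wave w x) (V t)" for x t
    unfolding Zw V_def ..
  have "(V has_vector_derivative
      (\<Sum>d=1..3. (- (\<sigma> *\<^sub>R A d t) + rot_freq d w *\<^sub>R B d t) *s vb d w,
       \<Sum>d=1..3. (- (rot_freq d w *\<^sub>R A d t)) *s vb d w)) (at t)"
    unfolding V_def using pair unfolding damped_pair_def
    by (intro has_vector_derivative_Pair has_vector_derivative_sum
        bounded_linear.has_vector_derivative[OF bounded_linear_smult_left]) auto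
  also have "(\<Sum>d=1..3. (- (\<sigma> *\<^sub>R A d t) + rot_freq d w *\<^sub>R B d t) *s vb d w,
       \<Sum>d=1..3. (- (rot_freq d w *\<^sub>R A d t)) *s vb d w) = maxwell_symbol \<sigma> w (V t)"
  proof -
    have "icross w (\<Sum>d=1..3. f d *s vb d w) = (\<Sum>d=1..3. (rot_freq d w *\<^sub>R f d) *s vb d w)" for f :: "nat \<Rightarrow> complex"
      unfolding linear_sum[OF linear_icross] icross_smult icross_vb[OF w]
      by (simp add: scaleR_conv_of_real mult.commute)
    then show ?thesis
      unfolding maxwell_symbol_def V_def
      by (simp add: sum.distrib sum_negf sum_subtractf scaleR_sum_right vector_sadd_rdistrib vec_eq_iff algebra_simps)
  qed
  finally have V: "(V has_vector_derivative maxwell_symbol \<sigma> w (V t)) (at t)" .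
  show "((\<lambda>s. Zw \<sigma> a b w x s) has_vector_derivative maxwell_symbol \<sigma> w (Zw \<sigma> a b w x t)) (at t)"
    unfolding Zw maxwell_symbol_scale6
    by (rule bounded_linear.has_vector_derivative[OF
          bounded_bilinear.bounded_linear_right[OF bounded_bilinear_scale6] V])
  show "Zw \<sigma> a b w x 0 = scale6 (plane_wave w x) (fourier_coeff a b w)"
    unfolding Zw V_def fourier_coeff_def
    by (intro arg_cong2[where f = scale6] arg_cong2[where f = Pair] sum.cong refl) (simp_all only: A0 B0)
  show "norm (Zw \<sigma> a b w x t) \<le> 4 * exp (\<sigma> * \<bar>t\<bar>) * amp_size a b w"
  proof -
    have "norm (\<Sum>d=1..3. f d *s vb d w) \<le> (\<Sum>d=1..3. norm (f d) * 2)" for f :: "nat \<Rightarrow> complex"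
      by (rule sum_norm_le) (auto simp: norm_vector_smult_complex intro: mult_left_mono norm_vb_le[OF w])
    from this[of "\<lambda>d. A d t"] this[of "\<lambda>d. B d t"]
    have "norm (V t) \<le> (\<Sum>d=1..3. norm (A d t) * 2) + (\<Sum>d=1..3. norm (B d t) * 2)"
      unfolding V_def by (intro order_trans[OF norm_Pair_le] add_mono)
    also have "\<dots> = (\<Sum>d=1..3. 2 * (norm (A d t) + norm (B d t)))"
      by (simp add: sum.distrib sum_distrib_left mult.commute)
    also have "\<dots> \<le> (\<Sum>d=1..3. 2 * (2 * exp (\<sigma> * \<bar>t\<bar>) * (norm (a d w) + norm (b d w))))"
    proof (intro sum_mono mult_left_mono)
      fix d :: nat assume d: "d \<in> {1..3}"
      show "norm (A d t) + norm (B d t) \<le> 2 * exp (\<sigma> * \<bar>t\<bar>) * (norm (a d w) + norm (b d w))"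
        using damped_energy_bound[of \<sigma> "A d" "rot_freq d w" "B d" t] pair[OF d] \<sigma> A0[OF d] B0[OF d]
        unfolding damped_pair_def by auto
    qed auto
    also have "\<dots> = 4 * exp (\<sigma> * \<bar>t\<bar>) * amp_size a b w"
      by (simp add: amp_size_def sum_distrib_left mult.assoc)
    finally show ?thesis unfolding Zw norm_scale6 norm_plane_wave by simp
  qed
  have "((\<lambda>y. \<i> * complex_of_real (y \<bullet> w)) has_derivative (\<lambda>h. \<i> * complex_of_real (h \<bullet> w))) (at x)"
    by (auto intro!: derivative_eq_intros)
  from has_derivative_compose[OF this DERIV_exp[unfolded has_field_derivative_def]]
  have "((\<lambda>y. plane_wave w y) has_derivative (\<lambda>h. \<i> * complex_of_real (h \<bullet> w) * plane_wave w x)) (at x)"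
    unfolding plane_wave_def by (simp add: mult_ac)
  then show "((\<lambda>y. Zw \<sigma> a b w y t) has_derivative
        (\<lambda>h. scale6 (\<i> * complex_of_real (h \<bullet> w)) (Zw \<sigma> a b w x t))) (at x)"
    unfolding Zw scale6_scale6
    by (rule bounded_linear.has_derivative[OF
          bounded_bilinear.bounded_linear_left[OF bounded_bilinear_scale6]])
qed

section \<open>Summation over the wave vectors\<close>

text \<open>The summability hypothesis carries the weight \<open>norm w\<close>. As wave vectors are bounded away from zero, the weight
can be removed.\<close>

lemma amp_size_summable:
  assumes "inj p" and "independent (range p)"
    and "(\<lambda>w. norm w * amp_size a b w) summable_on wave_vectors p"
  shows "amp_size a b summable_on wave_vectors p"
proof -
  obtain \<delta> where \<delta>: "\<delta> > 0" "\<And>w. w \<in> wave_vectors p \<Longrightarrow> \<delta> \<le> norm w"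
    using wave_vectors_norm_ge assms(1,2) by blast
  have "(\<lambda>w. 1 / \<delta> * (norm w * amp_size a b w)) summable_on wave_vectors p"
    using assms(3) by (rule summable_on_cmult_right)
  then show ?thesis
  proof (rule summable_on_comparison_test)
    show "amp_size a b w \<le> 1 / \<delta> * (norm w * amp_size a b w)" if "w \<in> wave_vectors p" for w
      using mult_right_mono[OF \<delta>(2)[OF that] amp_size_nonneg[of a b w]] \<delta>(1) by (simp add: field_simps)
  qed (rule amp_size_nonneg)
qed

text \<open>A derivative of a mode, in space or in time, costs at most a factor \<open>norm w\<close> or \<open>\<sigma> + 12 * norm w\<close>. The weighted
sum of the amplitudes therefore dominates all derivatives, and the series may be differentiated term by term.\<close>

lemma
  assumes \<sigma>: "\<sigma> > 0"
    and S: "amp_size a b summable_on wave_vectors p"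
    and wS: "(\<lambda>w. norm w * amp_size a b w) summable_on wave_vectors p"
  shows Zw_summable: "(\<lambda>w. Zw \<sigma> a b w x t) summable_on wave_vectors p"
    and Zsol_space_derivative: "((\<lambda>y. Zsol p \<sigma> a b y t) has_derivative
        (\<lambda>h. \<Sum>\<^sub>\<infinity>w\<in>wave_vectors p. scale6 (\<i> * complex_of_real (h \<bullet> w)) (Zw \<sigma> a b w x t))) (at x)"
    and Zw_space_derivative_summable:
      "(\<lambda>w. scale6 (\<i> * complex_of_real (h \<bullet> w)) (Zw \<sigma> a b w x t)) summable_on wave_vectors p"
    and Zsol_time_derivative: "((\<lambda>s. Zsol p \<sigma> a b x s) has_vector_derivative
        (\<Sum>\<^sub>\<infinity>w\<in>wave_vectors p. maxwell_symbol \<sigma> w (Zw \<sigma> a b w x t))) (at t)"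
proof -
  have nz: "w \<noteq> 0" if "w \<in> wave_vectors p" for w
    using that by (simp add: wave_vectors_def)
  have summ: "(\<lambda>w. Zw \<sigma> a b w x t) summable_on wave_vectors p" for x t
    by (rule abs_summable_summable, rule Infinite_Sum.abs_summable_on_comparison_test'[OF
          summable_on_cmult_right[OF S, of "4 * exp (\<sigma> * \<bar>t\<bar>)"]])
       (use norm_Zw_le[OF \<sigma> nz] in auto)
  then show "(\<lambda>w. Zw \<sigma> a b w x t) summable_on wave_vectors p" .
  define M where "M w = 4 * exp (\<sigma> * \<bar>t\<bar>) * (norm w * amp_size a b w)" for w
  have M: "M summable_on wave_vectors p"
    unfolding M_def using wS by (rule summable_on_cmult_right)
  have M0: "M w \<ge> 0" for w
    unfolding M_def by (simp add: amp_size_nonneg)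
  have bound: "norm (scale6 (\<i> * complex_of_real (h \<bullet> w)) (Zw \<sigma> a b w y t)) \<le> M w * norm h"
    if "w \<in> wave_vectors p" for w h y
  proof -
    have "norm (scale6 (\<i> * complex_of_real (h \<bullet> w)) (Zw \<sigma> a b w y t)) = \<bar>h \<bullet> w\<bar> * norm (Zw \<sigma> a b w y t)"
      by (simp add: norm_scale6 norm_mult)
    also have "\<dots> \<le> (norm h * norm w) * (4 * exp (\<sigma> * \<bar>t\<bar>) * amp_size a b w)"
      using norm_Zw_le[OF \<sigma> nz[OF that]] Cauchy_Schwarz_ineq2[of h w] by (intro mult_mono) auto
    finally show ?thesis by (simp add: M_def mult_ac)
  qed
  show "((\<lambda>y. Zsol p \<sigma> a b y t) has_derivative
        (\<lambda>h. \<Sum>\<^sub>\<infinity>w\<in>wave_vectors p. scale6 (\<i> * complex_of_real (h \<bullet> w)) (Zw \<sigma> a b w x t))) (at x)"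
    unfolding Zsol_def
    by (rule has_derivative_infsum[where S = UNIV and M = M and f = "\<lambda>w y. Zw \<sigma> a b w y t"
          and f' = "\<lambda>w y h. scale6 (\<i> * complex_of_real (h \<bullet> w)) (Zw \<sigma> a b w y t)"])
       (use Zw_space_derivative[OF \<sigma> nz] bound M0 M summ in auto)
  show "(\<lambda>w. scale6 (\<i> * complex_of_real (h \<bullet> w)) (Zw \<sigma> a b w x t)) summable_on wave_vectors p"
    by (rule abs_summable_summable, rule Infinite_Sum.abs_summable_on_comparison_test'[OF
          summable_on_cmult_left[OF M, of "norm h"]]) (rule bound)
  \<comment> \<open>The growth bound depends on time, so a dominating family exists only on bounded time intervals.\<close>
  define T where "T = \<bar>t\<bar> + 1"
  define N where "N w = 4 * exp (\<sigma> * T) * (\<sigma> * amp_size a b w + 12 * (norm w * amp_size a b w))" for w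
  have N: "N summable_on wave_vectors p"
    unfolding N_def by (intro summable_on_cmult_right summable_on_add S wS)
  have N0: "N w \<ge> 0" for w
    unfolding N_def using \<sigma> by (simp add: amp_size_nonneg)
  have tbound: "norm (maxwell_symbol \<sigma> w (Zw \<sigma> a b w x s)) \<le> N w"
    if w: "w \<in> wave_vectors p" and s: "s \<in> {-T<..<T}" for w s
  proof -
    have "norm (maxwell_symbol \<sigma> w (Zw \<sigma> a b w x s)) \<le> (\<sigma> + 12 * norm w) * norm (Zw \<sigma> a b w x s)"
      using norm_maxwell_symbol_le \<sigma> by simp
    also have "\<dots> \<le> (\<sigma> + 12 * norm w) * (4 * exp (\<sigma> * \<bar>s\<bar>) * amp_size a b w)"
      using norm_Zw_le[OF \<sigma> nz[OF w]] \<sigma> by (intro mult_left_mono) auto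
    also have "\<dots> \<le> (\<sigma> + 12 * norm w) * (4 * exp (\<sigma> * T) * amp_size a b w)"
      using \<sigma> s amp_size_nonneg by (intro mult_left_mono mult_right_mono) auto
    finally show ?thesis by (simp add: N_def algebra_simps)
  qed
  have "((\<lambda>s. Zsol p \<sigma> a b x s) has_derivative
        (\<lambda>h. \<Sum>\<^sub>\<infinity>w\<in>wave_vectors p. h *\<^sub>R maxwell_symbol \<sigma> w (Zw \<sigma> a b w x t))) (at t)"
    unfolding Zsol_def
  proof (rule has_derivative_infsum[where S = "{-T<..<T}" and M = N and f = "\<lambda>w s. Zw \<sigma> a b w x s"
          and f' = "\<lambda>w s h. h *\<^sub>R maxwell_symbol \<sigma> w (Zw \<sigma> a b w x s)"])
    show "norm (h *\<^sub>R maxwell_symbol \<sigma> w (Zw \<sigma> a b w x s)) \<le> N w * norm h"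
      if "w \<in> wave_vectors p" "s \<in> {-T<..<T}" for w s h
      using mult_right_mono[OF tbound[OF that], of "\<bar>h\<bar>"] by (simp add: mult.commute)
    show "t \<in> {-T<..<T}" unfolding T_def by auto
  qed (use Zw_time_derivative[OF \<sigma> nz] N0 N summ in \<open>auto simp: has_vector_derivative_def\<close>)
  then show "((\<lambda>s. Zsol p \<sigma> a b x s) has_vector_derivative
        (\<Sum>\<^sub>\<infinity>w\<in>wave_vectors p. maxwell_symbol \<sigma> w (Zw \<sigma> a b w x t))) (at t)"
    unfolding has_vector_derivative_def infsum_scaleR_right .
qed

text \<open>The curl is linear in the derivative, so it may be exchanged with the sum; this applies to both components
of the field at once. Hence the time derivative and the Maxwell operator give the same sum of mode symbols.\<close>

lemma Zsol_solves:
  assumes \<sigma>: "\<sigma> > 0"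
    and S: "amp_size a b summable_on wave_vectors p"
    and wS: "(\<lambda>w. norm w * amp_size a b w) summable_on wave_vectors p"
  shows "((\<lambda>s. Zsol p \<sigma> a b x s) has_vector_derivative Bop \<sigma> (\<lambda>y. Zsol p \<sigma> a b y t) x) (at t)"
proof -
  let ?W = "wave_vectors p"
  define z where "z w = Zw \<sigma> a b w x t" for w
  define D where "D h = (\<Sum>\<^sub>\<infinity>w\<in>?W. scale6 (\<i> * complex_of_real (h \<bullet> w)) (z w))" for h
  have D: "((\<lambda>y. Zsol p \<sigma> a b y t) has_derivative D) (at x)"
    unfolding D_def z_def by (rule Zsol_space_derivative[OF assms])
  have hsD: "((\<lambda>w. scale6 (\<i> * complex_of_real (h \<bullet> w)) (z w)) has_sum D h) ?W" for h
    unfolding D_def z_def by (intro has_sum_infsum Zw_space_derivative_summable[OF assms])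
  have hsZ: "(z has_sum Zsol p \<sigma> a b x t) ?W"
    unfolding z_def Zsol_def by (intro has_sum_infsum Zw_summable[OF assms])
  have curl_sum: "((\<lambda>w. icross w (\<pi> (z w))) has_sum curl (\<lambda>y. \<pi> (Zsol p \<sigma> a b y t)) x) ?W"
    if \<pi>: "bounded_linear \<pi>" and scale: "\<And>c z. \<pi> (scale6 c z) = c *s \<pi> z"
    for \<pi> :: "(complex^3) \<times> (complex^3) \<Rightarrow> complex^3"
  proof -
    have "curl (\<lambda>y. \<pi> (Zsol p \<sigma> a b y t)) x = curl_of_deriv (\<lambda>h. \<pi> (D h))"
      by (rule curl_eq_curl_of_deriv[OF bounded_linear.has_derivative[OF \<pi> D]])
    moreover have "icross w (\<pi> (z w)) = curl_of_deriv (\<lambda>h. \<pi> (scale6 (\<i> * complex_of_real (h \<bullet> w)) (z w)))" for w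
      using curl_of_deriv_plane_wave[of w "\<pi> (z w)"] by (simp add: scale)
    ultimately show ?thesis
      using has_sum_curl_of_deriv[OF has_sum_bounded_linear[OF \<pi> hsD]] by simp
  qed
  have curls: "((\<lambda>w. icross w (fst (z w))) has_sum curl (\<lambda>y. fst (Zsol p \<sigma> a b y t)) x) ?W"
              "((\<lambda>w. icross w (snd (z w))) has_sum curl (\<lambda>y. snd (Zsol p \<sigma> a b y t)) x) ?W"
    by (rule curl_sum; simp add: bounded_linear_fst bounded_linear_snd scale6_def)+
  have damping: "((\<lambda>w. - (\<sigma> *\<^sub>R fst (z w))) has_sum - (\<sigma> *\<^sub>R fst (Zsol p \<sigma> a b x t))) ?W"
    by (rule has_sum_bounded_linear[OF bounded_linear_minus[OF
          bounded_linear_compose[OF bounded_linear_scaleR_right bounded_linear_fst]] hsZ])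
  have "((\<lambda>w. - icross w (fst (z w))) has_sum - curl (\<lambda>y. fst (Zsol p \<sigma> a b y t)) x) ?W"
    using curls(1) by (simp add: has_sum_uminus)
  from has_sum_Pair[OF has_sum_add[OF damping curls(2)] this]
  have "((\<lambda>w. maxwell_symbol \<sigma> w (z w)) has_sum Bop \<sigma> (\<lambda>y. Zsol p \<sigma> a b y t) x) ?W"
    unfolding maxwell_symbol_def Bop_def .
  then have "(\<Sum>\<^sub>\<infinity>w\<in>?W. maxwell_symbol \<sigma> w (z w)) = Bop \<sigma> (\<lambda>y. Zsol p \<sigma> a b y t) x"
    by (rule infsumI)
  then show ?thesis
    using Zsol_time_derivative[OF assms, of x t] unfolding z_def by simp
qed

theorem theorem3p7:
  fixes \<sigma> :: real
    and p :: "3 \<Rightarrow> real^3"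
    and Z0 :: "real^3 \<Rightarrow> (complex^3) \<times> (complex^3)"
    and E0 H0 :: "real^3 \<Rightarrow> real^3"
    and a b :: "nat \<Rightarrow> real^3 \<Rightarrow> complex"
    and Z :: "real^3 \<Rightarrow> real \<Rightarrow> (complex^3) \<times> (complex^3)"
    and E H :: "real^3 \<Rightarrow> real \<Rightarrow> real^3"
  assumes "\<sigma> > 0"
    and "inj p" and "independent (range p)"
    and "\<And>x j. Z0 (x + p j) = Z0 x"
    and "\<And>x. ((\<lambda>w. scale6 (plane_wave w x) (fourier_coeff a b w)) has_sum Z0 x) (wave_vectors p)"
    and "\<And>x. E0 x = Rev (fst (Z0 x))" and "\<And>x. H0 x = Rev (snd (Z0 x))"
    and "(\<lambda>w. norm w * (\<Sum>d=1..3. norm (a d w) + norm (b d w))) summable_on wave_vectors p"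
    and "\<And>x t. Z x t = Zsol p \<sigma> a b x t"
    and "\<And>x t. E x t = Rev (fst (Z x t))" and "\<And>x t. H x t = Rev (snd (Z x t))"
  shows "(\<forall>x t. (\<lambda>w. Zw \<sigma> a b w x t) summable_on wave_vectors p)
    \<and> (\<forall>x t. (\<lambda>y. Z y t) differentiable (at x))
    \<and> (\<forall>x t. ((\<lambda>s. Z x s) has_vector_derivative Bop \<sigma> (\<lambda>y. Z y t) x) (at t))
    \<and> (\<forall>x. Z x 0 = Z0 x)
    \<and> (\<forall>x t. (\<lambda>y. E y t) differentiable (at x) \<and> (\<lambda>y. H y t) differentiable (at x))
    \<and> (\<forall>x t. ((\<lambda>s. E x s) has_vector_derivative
                (- (\<sigma> *\<^sub>R E x t) + curl (\<lambda>y. H y t) x)) (at t))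
    \<and> (\<forall>x t. ((\<lambda>s. H x s) has_vector_derivative (- curl (\<lambda>y. E y t) x)) (at t))
    \<and> (\<forall>x. E x 0 = E0 x) \<and> (\<forall>x. H x 0 = H0 x)"
proof -
  note \<sigma> = \<open>\<sigma> > 0\<close>
  have wS: "(\<lambda>w. norm w * amp_size a b w) summable_on wave_vectors p"
    using assms(8) unfolding amp_size_def .
  have S: "amp_size a b summable_on wave_vectors p"
    using amp_size_summable[OF assms(2,3) wS] .
  have Z: "Z = Zsol p \<sigma> a b" and E: "E = (\<lambda>x t. Rev (fst (Z x t)))" and H: "H = (\<lambda>x t. Rev (snd (Z x t)))"
    by (intro ext assms)+
  have diff: "(\<lambda>y. Z y t) differentiable (at x)" for x t
    unfolding Z using Zsol_space_derivative[OF \<sigma> S wS] by (rule differentiableI)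
  have diff_lin: "(\<lambda>y. \<pi> (Z y t)) differentiable (at x)" if "bounded_linear \<pi>"
    for \<pi> :: "(complex^3) \<times> (complex^3) \<Rightarrow> 'b::real_normed_vector" and x t
    using diff bounded_linear.has_derivative[OF that] unfolding differentiable_def by blast
  have "(\<lambda>y. E y t) differentiable (at x)" "(\<lambda>y. H y t) differentiable (at x)" for x t
    unfolding E H
    by (rule diff_lin[OF bounded_linear_compose[OF bounded_linear_Rev bounded_linear_fst]]
             diff_lin[OF bounded_linear_compose[OF bounded_linear_Rev bounded_linear_snd]])+
  moreover have ev: "((\<lambda>s. Z x s) has_vector_derivative Bop \<sigma> (\<lambda>y. Z y t) x) (at t)" for x t
    unfolding Z by (rule Zsol_solves[OF \<sigma> S wS])
  moreover have initial: "Z x 0 = Z0 x" for x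
  proof -
    have "Zsol p \<sigma> a b x 0 = (\<Sum>\<^sub>\<infinity>w\<in>wave_vectors p. scale6 (plane_wave w x) (fourier_coeff a b w))"
      unfolding Zsol_def by (rule infsum_cong, rule Zw_initial[OF \<sigma>]) (simp add: wave_vectors_def)
    then show ?thesis using infsumI[OF assms(5)] unfolding Z by simp
  qed
  moreover have "((\<lambda>s. E x s) has_vector_derivative (- (\<sigma> *\<^sub>R E x t) + curl (\<lambda>y. H y t) x)) (at t)" for x t
  proof -
    have "((\<lambda>s. Rev (fst (Z x s))) has_vector_derivative Rev (fst (Bop \<sigma> (\<lambda>y. Z y t) x))) (at t)"
      by (intro bounded_linear.has_vector_derivative[OF bounded_linear_Rev]
          bounded_linear.has_vector_derivative[OF bounded_linear_fst] ev)
    then show ?thesis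
      unfolding E H curl_Rev[OF diff_lin[OF bounded_linear_snd]] by (simp add: Bop_def Rev_def vec_eq_iff plus_vec_def uminus_vec_def scaleR_vec_def)
  qed
  moreover have "((\<lambda>s. H x s) has_vector_derivative (- curl (\<lambda>y. E y t) x)) (at t)" for x t
  proof -
    have "((\<lambda>s. Rev (snd (Z x s))) has_vector_derivative Rev (snd (Bop \<sigma> (\<lambda>y. Z y t) x))) (at t)"
      by (intro bounded_linear.has_vector_derivative[OF bounded_linear_Rev]
          bounded_linear.has_vector_derivative[OF bounded_linear_snd] ev)
    then show ?thesis
      unfolding E H curl_Rev[OF diff_lin[OF bounded_linear_fst]] by (simp add: Bop_def Rev_def uminus_vec_def)
  qed
  ultimately show ?thesis
    using diff Zw_summable[OF \<sigma> S wS] assms(6,7) by (simp add: E H)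
qed

end
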